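(* For every integer $n\ge 1$ there exist a graph $G$ on $n$ vertices, a finite color set $\tau$, and proper $\tau$-colorings $\phi_1,\phi_2$ of $G$ such that a shortest proper walk from $X(\phi_1)$ to $X(\phi_2)$ in the fractional coloring polytope of $G$ and $\tau$ has length $n$.
   Context: A proper $\tau$-coloring of $G=(V,E)$ is a map $\phi:V\to\tau$ with $\phi(u)\neq\phi(v)$ for every edge $uv\in E$. Its coloring characteristic vector $X(\phi)\in\{0,1\}^{V\times\tau}$ has entry $1$ at $(v,i)$ if $\phi(v)=i$ and $0$ otherwise. The fractional coloring polytope $P$ of $G$ and $\tau$ is the set of $x\in\mathbb{R}^{V\times\tau}$ satisfying $$\sum_{i\in\tau}x(v,i)=1\ \ \forall v\in V,\qquad x(v,i)+x(u,i)\le 1\ \ \forall i\in\tau,\ uv\in E,\qquad x(v,i)\ge 0\ \ \forall v\in V, i\in\tau.$$ Let $A$ be its equality constraint matrix and $B$ its inequality constraint matrix. Its circuits $\mathcal{C}(A,B)$ are the vectors $g\in\ker(A)\setminus\{0\}$, normalized to coprime integer components, for which the support of $Bg$ is inclusion-minimal among the supports of $\{Bx : x\in\ker(A)\setminus\{0\}\}$. A circuit walk of length $k$ in $P$ is a sequence $x_0,\ldots,x_k$ of points of $P$ starting at an extreme point $x_0$ such that for each $i=0,\ldots,k-1$, $x_{i+1}=x_i+\epsilon_i g_i$ for some $g_i\in\mathcal{C}(A,B)$ and $\epsilon_i>0$, where $x_i+\epsilon g_i\notin P$ for all $\epsilon>\epsilon_i$. A circuit walk from $X(\phi_1)$ to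 $X(\phi_2)$ is called a proper walk if each point $x_0,\ldots,x_k$ visited is the characteristic vector of a proper $\tau$-coloring of $G$. *)

theory Defs
  imports "HOL-Analysis.Analysis" "HOL-Analysis.Finite_Function_Topology"
begin

definition simple_graph :: "'v set \<Rightarrow> 'v set set \<Rightarrow> bool" where
  "simple_graph V E \<longleftrightarrow> finite V \<and> E \<subseteq> {e. e \<subseteq> V \<and> card e = 2}"

definition proper_coloring :: "'v set \<Rightarrow> 'v set set \<Rightarrow> 'c set \<Rightarrow> ('v \<Rightarrow> 'c) \<Rightarrow> bool" where
  "proper_coloring V E T \<phi> \<longleftrightarrow>
     \<phi> \<in> V \<rightarrow> T \<and> (\<forall>u v. {u, v} \<in> E \<longrightarrow> \<phi> u \<noteq> \<phi> v)"

text \<open>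
  For a finite index set \<open>C\<close>, the space of real vectors indexed by \<open>C\<close> is represented by the finitely
  supported maps that vanish outside \<open>C\<close>. This makes the vector space operations and
  \<^const>\<open>extreme_point_of\<close> available although the index set is not a type.
\<close>

definition vectors_on :: "'i set \<Rightarrow> ('i \<Rightarrow>\<^sub>0 real) set" where
  "vectors_on C = {x. Poly_Mapping.keys x \<subseteq> C}"

text \<open>The map below has finite support, as \<^const>\<open>Abs_poly_mapping\<close> requires, when \<open>V\<close> is finite.\<close>

definition char_vector :: "'v set \<Rightarrow> ('v \<Rightarrow> 'c) \<Rightarrow> (('v \<times> 'c) \<Rightarrow>\<^sub>0 real)" where
  "char_vector V \<phi> = Abs_poly_mapping (\<lambda>(v, i). if v \<in> V \<and> \<phi> v = i then 1 else 0)"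

lemma lookup_char_vector:
  assumes "finite V"
  shows "Poly_Mapping.lookup (char_vector V \<phi>) (v, i) = (if v \<in> V \<and> \<phi> v = i then 1 else 0)"
proof -
  have "{p. (case p of (v, i) \<Rightarrow> if v \<in> V \<and> \<phi> v = i then 1 else 0) \<noteq> (0::real)}
          \<subseteq> (\<lambda>v. (v, \<phi> v)) ` V"
    by (auto split: if_splits)
  then have "finite {p. (case p of (v, i) \<Rightarrow> if v \<in> V \<and> \<phi> v = i then 1 else 0) \<noteq> (0::real)}"
    using assms by (meson finite_imageI finite_subset)
  then show ?thesis
    by (simp add: char_vector_def)
qed

definition coloring_polytope :: "'v set \<Rightarrow> 'v set set \<Rightarrow> 'c set \<Rightarrow> (('v \<times> 'c) \<Rightarrow>\<^sub>0 real) set" where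
  "coloring_polytope V E T =
     {x \<in> vectors_on (V \<times> T).
        (\<forall>v\<in>V. (\<Sum>i\<in>T. Poly_Mapping.lookup x (v, i)) = 1) \<and>
        (\<forall>i\<in>T. \<forall>u v. {u, v} \<in> E \<longrightarrow>
            Poly_Mapping.lookup x (v, i) + Poly_Mapping.lookup x (u, i) \<le> 1) \<and>
        (\<forall>v\<in>V. \<forall>i\<in>T. Poly_Mapping.lookup x (v, i) \<ge> 0)}"

text \<open>
  A matrix is a function of a row index and a column index. Its index sets are passed explicitly:
  \<open>C\<close> for the columns, \<open>R\<close> for the rows of \<open>A\<close> and \<open>S\<close> for the rows of \<open>B\<close>.
\<close>

definition mat_vec :: "'i set \<Rightarrow> ('r \<Rightarrow> 'i \<Rightarrow> real) \<Rightarrow> ('i \<Rightarrow>\<^sub>0 real) \<Rightarrow> 'r \<Rightarrow> real" where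
  "mat_vec C M x r = (\<Sum>c\<in>C. M r c * Poly_Mapping.lookup x c)"

definition mat_ker :: "'i set \<Rightarrow> 'r set \<Rightarrow> ('r \<Rightarrow> 'i \<Rightarrow> real) \<Rightarrow> ('i \<Rightarrow>\<^sub>0 real) set" where
  "mat_ker C R A = {x \<in> vectors_on C. \<forall>r\<in>R. mat_vec C A x r = 0}"

definition mat_vec_support :: "'i set \<Rightarrow> 's set \<Rightarrow> ('s \<Rightarrow> 'i \<Rightarrow> real) \<Rightarrow> ('i \<Rightarrow>\<^sub>0 real) \<Rightarrow> 's set" where
  "mat_vec_support C S B x = {s \<in> S. mat_vec C B x s \<noteq> 0}"

definition coprime_integral :: "'i set \<Rightarrow> ('i \<Rightarrow>\<^sub>0 real) \<Rightarrow> bool" where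
  "coprime_integral C g \<longleftrightarrow>
     (\<forall>c\<in>C. Poly_Mapping.lookup g c \<in> \<int>) \<and> Gcd ((\<lambda>c. \<lfloor>Poly_Mapping.lookup g c\<rfloor>) ` C) = 1"

definition circuits ::
  "'i set \<Rightarrow> 'r set \<Rightarrow> ('r \<Rightarrow> 'i \<Rightarrow> real) \<Rightarrow> 's set \<Rightarrow> ('s \<Rightarrow> 'i \<Rightarrow> real) \<Rightarrow> ('i \<Rightarrow>\<^sub>0 real) set" where
  "circuits C R A S B =
     {g \<in> mat_ker C R A - {0}. coprime_integral C g \<and>
        \<not> (\<exists>x \<in> mat_ker C R A - {0}. mat_vec_support C S B x \<subset> mat_vec_support C S B g)}"

definition coloring_eq_mat :: "'v \<Rightarrow> 'v \<times> 'c \<Rightarrow> real" where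
  "coloring_eq_mat v = (\<lambda>(w, j). if w = v then 1 else 0)"

text \<open>
  The inequalities are written as \<open>B x \<le> d\<close>. The row \<open>Inl (e, i)\<close> belongs to the edge \<open>e\<close> and the color
  \<open>i\<close>, and the row \<open>Inr (v, i)\<close> to the nonnegativity constraint of \<open>x (v, i)\<close>.
\<close>

definition coloring_ineq_rows ::
  "'v set \<Rightarrow> 'v set set \<Rightarrow> 'c set \<Rightarrow> (('v set \<times> 'c) + ('v \<times> 'c)) set" where
  "coloring_ineq_rows V E T = (E \<times> T) <+> (V \<times> T)"

definition coloring_ineq_mat :: "('v set \<times> 'c) + ('v \<times> 'c) \<Rightarrow> 'v \<times> 'c \<Rightarrow> real" where
  "coloring_ineq_mat r = (\<lambda>(w, j). case r of
       Inl (e, i) \<Rightarrow> (if w \<in> e \<and> j = i then 1 else 0)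
     | Inr (v, i) \<Rightarrow> (if w = v \<and> j = i then - 1 else 0))"

definition coloring_ineq_rhs :: "('v set \<times> 'c) + ('v \<times> 'c) \<Rightarrow> real" where
  "coloring_ineq_rhs r = (case r of Inl _ \<Rightarrow> 1 | Inr _ \<Rightarrow> 0)"

lemma mat_vec_coloring_eq_mat:
  assumes "finite V" "finite T" "v \<in> V"
  shows "mat_vec (V \<times> T) coloring_eq_mat x v = (\<Sum>i\<in>T. Poly_Mapping.lookup x (v, i))"
proof -
  have "mat_vec (V \<times> T) coloring_eq_mat x v
      = (\<Sum>w\<in>V. \<Sum>j\<in>T. (if w = v then 1 else 0) * Poly_Mapping.lookup x (w, j))"
    by (simp add: mat_vec_def coloring_eq_mat_def sum.cartesian_product case_prod_beta)
  also have "\<dots> = (\<Sum>w\<in>V. if w = v then \<Sum>j\<in>T. Poly_Mapping.lookup x (w, j) else 0)"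
    by (intro sum.cong) auto
  finally show ?thesis
    using assms by simp
qed

lemma mat_vec_coloring_ineq_mat_edge:
  assumes "finite V" "finite T" "e \<subseteq> V" "i \<in> T"
  shows "mat_vec (V \<times> T) coloring_ineq_mat x (Inl (e, i)) = (\<Sum>w\<in>e. Poly_Mapping.lookup x (w, i))"
proof -
  have "mat_vec (V \<times> T) coloring_ineq_mat x (Inl (e, i))
      = (\<Sum>w\<in>V. \<Sum>j\<in>T. (if w \<in> e \<and> j = i then 1 else 0) * Poly_Mapping.lookup x (w, j))"
    by (simp add: mat_vec_def coloring_ineq_mat_def sum.cartesian_product case_prod_beta)
  also have "\<dots> = (\<Sum>w\<in>V. \<Sum>j\<in>T. if j = i then (if w \<in> e then Poly_Mapping.lookup x (w, j) else 0) else 0)"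
    by (intro sum.cong) auto
  also have "\<dots> = (\<Sum>w\<in>V. if w \<in> e then Poly_Mapping.lookup x (w, i) else 0)"
    using assms by simp
  also have "\<dots> = (\<Sum>w\<in>V \<inter> e. Poly_Mapping.lookup x (w, i))"
    using assms(1) by (simp add: sum.inter_restrict)
  finally show ?thesis
    using assms(3) by (simp add: Int_absorb1)
qed

lemma mat_vec_coloring_ineq_mat_nonneg:
  assumes "finite V" "finite T" "v \<in> V" "i \<in> T"
  shows "mat_vec (V \<times> T) coloring_ineq_mat x (Inr (v, i)) = - Poly_Mapping.lookup x (v, i)"
proof -
  have "mat_vec (V \<times> T) coloring_ineq_mat x (Inr (v, i))
      = (\<Sum>p\<in>V \<times> T. if p = (v, i) then - Poly_Mapping.lookup x p else 0)"
    unfolding mat_vec_def coloring_ineq_mat_def by (intro sum.cong) (auto split: if_splits)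
  then show ?thesis
    using assms by simp
qed

lemma coloring_polytope_mat:
  assumes "simple_graph V E" "finite T"
  shows "coloring_polytope V E T =
    {x \<in> vectors_on (V \<times> T).
       (\<forall>v\<in>V. mat_vec (V \<times> T) coloring_eq_mat x v = 1) \<and>
       (\<forall>r\<in>coloring_ineq_rows V E T. mat_vec (V \<times> T) coloring_ineq_mat x r \<le> coloring_ineq_rhs r)}"
proof -
  have V: "finite V" and E: "\<And>e. e \<in> E \<Longrightarrow> e \<subseteq> V \<and> card e = 2"
    using assms(1) by (auto simp: simple_graph_def)
  have edges: "(\<forall>i\<in>T. \<forall>u v. {u, v} \<in> E \<longrightarrow>
                   Poly_Mapping.lookup x (v, i) + Poly_Mapping.lookup x (u, i) \<le> 1)
      \<longleftrightarrow> (\<forall>e\<in>E. \<forall>i\<in>T. mat_vec (V \<times> T) coloring_ineq_mat x (Inl (e, i)) \<le> 1)"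
    for x :: "('a \<times> 'b) \<Rightarrow>\<^sub>0 real"
  proof -
    have pair: "mat_vec (V \<times> T) coloring_ineq_mat x (Inl ({u, v}, i))
          = Poly_Mapping.lookup x (v, i) + Poly_Mapping.lookup x (u, i)"
      if "{u, v} \<in> E" "i \<in> T" for u v i
    proof -
      have "u \<noteq> v" using E[OF that(1)] by auto
      then show ?thesis
        using mat_vec_coloring_ineq_mat_edge[OF V assms(2) _ that(2), of "{u, v}" x] E[OF that(1)]
        by simp
    qed
    have "\<exists>u v. e = {u, v}" if "e \<in> E" for e
      using E[OF that] by (auto simp: card_2_iff)
    then show ?thesis
      using pair by (metis (no_types, lifting))
  qed
  have rows: "(\<forall>r\<in>coloring_ineq_rows V E T.
                  mat_vec (V \<times> T) coloring_ineq_mat x r \<le> coloring_ineq_rhs r)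
      \<longleftrightarrow> (\<forall>e\<in>E. \<forall>i\<in>T. mat_vec (V \<times> T) coloring_ineq_mat x (Inl (e, i)) \<le> 1) \<and>
          (\<forall>v\<in>V. \<forall>i\<in>T. mat_vec (V \<times> T) coloring_ineq_mat x (Inr (v, i)) \<le> 0)"
    for x :: "('a \<times> 'b) \<Rightarrow>\<^sub>0 real"
    by (simp add: coloring_ineq_rows_def coloring_ineq_rhs_def Plus_def ball_Un)
  show ?thesis
    unfolding coloring_polytope_def rows edges
    by (simp add: mat_vec_coloring_eq_mat[OF V assms(2)]
          mat_vec_coloring_ineq_mat_nonneg[OF V assms(2)])
qed

definition coloring_circuits :: "'v set \<Rightarrow> 'v set set \<Rightarrow> 'c set \<Rightarrow> (('v \<times> 'c) \<Rightarrow>\<^sub>0 real) set" where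
  "coloring_circuits V E T =
     circuits (V \<times> T) V coloring_eq_mat (coloring_ineq_rows V E T) coloring_ineq_mat"

text \<open>A walk of length \<open>k\<close> consists of the points \<open>x 0, \<dots>, x k\<close>; later values of \<open>x\<close> are irrelevant.\<close>

definition circuit_walk ::
  "'a::real_vector set \<Rightarrow> 'a set \<Rightarrow> nat \<Rightarrow> (nat \<Rightarrow> 'a) \<Rightarrow> bool" where
  "circuit_walk P \<C> k x \<longleftrightarrow>
     (\<forall>i\<le>k. x i \<in> P) \<and> x 0 extreme_point_of P \<and>
     (\<forall>i<k. \<exists>g\<in>\<C>. \<exists>\<epsilon>>0. x (Suc i) = x i + \<epsilon> *\<^sub>R g \<and> (\<forall>\<delta>>\<epsilon>. x i + \<delta> *\<^sub>R g \<notin> P))"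

definition proper_walk ::
  "'v set \<Rightarrow> 'v set set \<Rightarrow> 'c set \<Rightarrow> ('v \<Rightarrow> 'c) \<Rightarrow> ('v \<Rightarrow> 'c) \<Rightarrow> nat
     \<Rightarrow> (nat \<Rightarrow> (('v \<times> 'c) \<Rightarrow>\<^sub>0 real)) \<Rightarrow> bool" where
  "proper_walk V E T \<phi>\<^sub>1 \<phi>\<^sub>2 k x \<longleftrightarrow>
     circuit_walk (coloring_polytope V E T) (coloring_circuits V E T) k x \<and>
     x 0 = char_vector V \<phi>\<^sub>1 \<and> x k = char_vector V \<phi>\<^sub>2 \<and>
     (\<forall>i\<le>k. \<exists>\<phi>. proper_coloring V E T \<phi> \<and> x i = char_vector V \<phi>)"

definition shortest_proper_walk ::
  "'v set \<Rightarrow> 'v set set \<Rightarrow> 'c set \<Rightarrow> ('v \<Rightarrow> 'c) \<Rightarrow> ('v \<Rightarrow> 'c) \<Rightarrow> nat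
     \<Rightarrow> (nat \<Rightarrow> (('v \<times> 'c) \<Rightarrow>\<^sub>0 real)) \<Rightarrow> bool" where
  "shortest_proper_walk V E T \<phi>\<^sub>1 \<phi>\<^sub>2 k x \<longleftrightarrow>
     proper_walk V E T \<phi>\<^sub>1 \<phi>\<^sub>2 k x \<and> (\<forall>l y. proper_walk V E T \<phi>\<^sub>1 \<phi>\<^sub>2 l y \<longrightarrow> k \<le> l)"

end

theory Submission
  imports Defs
begin

text \<open>
  A graph without edges suffices. Its coloring polytope is a product of simplices, one for each
  vertex. The restriction of a vector of \<open>ker A\<close> to the coordinates of a single vertex stays in
  \<open>ker A\<close>, and its support under \<open>B\<close> does not grow, because without edges \<open>B\<close> only consists of sign
  constraints on single coordinates. Minimality of the support therefore forces every circuit to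
  live on one vertex (\<open>edgeless_circuit_single_vertex\<close>), so that a circuit walk of length \<open>l\<close> can
  change at most \<open>l\<close> vertices (\<open>card_changed_vertices_le\<close>). If two colorings differ at all \<open>n\<close>
  vertices, every walk between them thus needs at least \<open>n\<close> steps.

  Conversely, giving one vertex its new color is a maximal step along a circuit
  (\<open>recoloring_in_circuits\<close>), and any coloring of an edgeless graph is proper, so \<open>n\<close> steps suffice
  (\<open>edgeless_proper_walk\<close>).
\<close>

section \<open>Colorings as extreme points of the polytope\<close>

lemma lookup_scaleR_poly_mapping:
  fixes x :: "'a \<Rightarrow>\<^sub>0 'b::real_vector"
  shows "Poly_Mapping.lookup (c *\<^sub>R x) p = c *\<^sub>R Poly_Mapping.lookup x p"
proof -
  have "finite {p. c *\<^sub>R Poly_Mapping.lookup x p \<noteq> 0}"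
    by (rule finite_subset[OF _ finite_lookup[of x]]) auto
  then show ?thesis by (simp add: scaleR_poly_mapping_def)
qed

lemma lookup_char_vector_if:
  assumes "finite V"
  shows "Poly_Mapping.lookup (char_vector V \<phi>) p = (if fst p \<in> V \<and> \<phi> (fst p) = snd p then 1 else 0)"
  using lookup_char_vector[OF assms, of \<phi> "fst p" "snd p"] by simp

lemma char_vector_in_polytope:
  assumes "simple_graph V E" "finite T" "proper_coloring V E T \<phi>"
  shows "char_vector V \<phi> \<in> coloring_polytope V E T"
proof -
  have V: "finite V" using assms(1) by (simp add: simple_graph_def)
  have \<phi>: "\<phi> v \<in> T" if "v \<in> V" for v
    using assms(3) that by (auto simp: proper_coloring_def)
  have edge: "\<phi> u \<noteq> \<phi> v" if "{u, v} \<in> E" for u v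
    using assms(3) that by (auto simp: proper_coloring_def)
  show ?thesis
    using \<phi> edge assms(2)
    by (auto simp: coloring_polytope_def vectors_on_def in_keys_iff lookup_char_vector_if[OF V]
        split: if_splits dest: edge)
qed

lemma coloring_polytope_lookup_le_1:
  assumes "finite T" "x \<in> coloring_polytope V E T" "v \<in> V" "i \<in> T"
  shows "Poly_Mapping.lookup x (v, i) \<le> 1"
proof -
  have "Poly_Mapping.lookup x (v, i) \<le> (\<Sum>i\<in>T. Poly_Mapping.lookup x (v, i))"
    using assms by (intro member_le_sum) (auto simp: coloring_polytope_def)
  also have "\<dots> = 1"
    using assms by (auto simp: coloring_polytope_def)
  finally show ?thesis .
qed

lemma coloring_polytope_lookup_outside:
  assumes "x \<in> coloring_polytope V E T" "p \<notin> V \<times> T"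
  shows "Poly_Mapping.lookup x p = 0"
  using assms by (auto simp: coloring_polytope_def vectors_on_def in_keys_iff)

text \<open>All coordinates of points of the polytope lie in \<open>[0, 1]\<close>, and those of a characteristic vector
  are endpoints of this interval, so it cannot be a proper convex combination.\<close>

lemma char_vector_extreme_point:
  assumes "simple_graph V E" "finite T" "proper_coloring V E T \<phi>"
  shows "char_vector V \<phi> extreme_point_of coloring_polytope V E T"
  unfolding extreme_point_of_def
proof (intro conjI ballI notI)
  have V: "finite V" using assms(1) by (simp add: simple_graph_def)
  show "char_vector V \<phi> \<in> coloring_polytope V E T"
    by (rule char_vector_in_polytope[OF assms])
  fix a b
  assume a: "a \<in> coloring_polytope V E T" and b: "b \<in> coloring_polytope V E T"
    and "char_vector V \<phi> \<in> open_segment a b"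
  then obtain t where ab: "a \<noteq> b" and t: "0 < t" "t < 1"
      and eq: "char_vector V \<phi> = (1 - t) *\<^sub>R a + t *\<^sub>R b"
    by (auto simp: in_segment)
  have "Poly_Mapping.lookup a p = Poly_Mapping.lookup b p" for p
  proof (cases "p \<in> V \<times> T")
    case True
    then obtain v i where p: "p = (v, i)" "v \<in> V" "i \<in> T" by auto
    let ?a = "Poly_Mapping.lookup a p" and ?b = "Poly_Mapping.lookup b p"
    have bounds: "0 \<le> ?a" "?a \<le> 1" "0 \<le> ?b" "?b \<le> 1"
      using a b p coloring_polytope_lookup_le_1[OF assms(2) a p(2,3)]
        coloring_polytope_lookup_le_1[OF assms(2) b p(2,3)]
      by (simp_all add: coloring_polytope_def)
    have comb: "Poly_Mapping.lookup (char_vector V \<phi>) p = (1 - t) * ?a + t * ?b"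
      by (simp add: eq lookup_add lookup_scaleR_poly_mapping)
    show ?thesis
    proof (cases "\<phi> v = i")
      case True
      then have "(1 - t) * (1 - ?a) + t * (1 - ?b) = 0"
        using comb p by (simp add: lookup_char_vector_if[OF V] algebra_simps)
      then have "(1 - t) * (1 - ?a) = 0 \<and> t * (1 - ?b) = 0"
        using t bounds by (subst (asm) add_nonneg_eq_0_iff) auto
      then show ?thesis using t by simp
    next
      case False
      then have "(1 - t) * ?a + t * ?b = 0"
        using comb p by (simp add: lookup_char_vector_if[OF V])
      then have "(1 - t) * ?a = 0 \<and> t * ?b = 0"
        using t bounds by (subst (asm) add_nonneg_eq_0_iff) auto
      then show ?thesis using t by simp
    qed
  next
    case False
    then show ?thesis
      using coloring_polytope_lookup_outside a b by metis
  qed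
  then have "a = b" by (intro poly_mapping_eqI)
  then show False using ab by simp
qed

section \<open>Circuits of edgeless graphs\<close>

lemma coloring_kernel_iff:
  assumes "finite V" "finite T"
  shows "x \<in> mat_ker (V \<times> T) V coloring_eq_mat \<longleftrightarrow>
    (\<forall>p. p \<notin> V \<times> T \<longrightarrow> Poly_Mapping.lookup x p = 0) \<and>
    (\<forall>v\<in>V. (\<Sum>i\<in>T. Poly_Mapping.lookup x (v, i)) = 0)"
  using assms
  by (auto simp: mat_ker_def vectors_on_def mat_vec_coloring_eq_mat in_keys_iff)

lemma edgeless_support:
  assumes "finite V" "finite T"
  shows "mat_vec_support (V \<times> T) (coloring_ineq_rows V {} T) coloring_ineq_mat x
    = Inr ` {p \<in> V \<times> T. Poly_Mapping.lookup x p \<noteq> 0}"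
  by (auto simp: mat_vec_support_def coloring_ineq_rows_def
      mat_vec_coloring_ineq_mat_nonneg[OF assms])

lemma edgeless_support_psubset_iff:
  assumes "finite V" "finite T"
  shows "mat_vec_support (V \<times> T) (coloring_ineq_rows V {} T) coloring_ineq_mat x
      \<subset> mat_vec_support (V \<times> T) (coloring_ineq_rows V {} T) coloring_ineq_mat y
    \<longleftrightarrow> {p \<in> V \<times> T. Poly_Mapping.lookup x p \<noteq> 0} \<subset> {p \<in> V \<times> T. Poly_Mapping.lookup y p \<noteq> 0}"
  unfolding edgeless_support[OF assms] by (simp add: inj_image_subset_iff psubset_eq inj_image_eq_iff)

text \<open>Otherwise the restriction of the circuit to one of its vertices would be a kernel vector of
  strictly smaller support.\<close>

lemma edgeless_circuit_single_vertex:
  assumes "finite V" "finite T" "g \<in> coloring_circuits V {} T"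
  obtains v where "\<And>w i. w \<noteq> v \<Longrightarrow> Poly_Mapping.lookup g (w, i) = 0"
proof -
  have g: "g \<in> mat_ker (V \<times> T) V coloring_eq_mat" "g \<noteq> 0"
    and min: "\<And>x. x \<in> mat_ker (V \<times> T) V coloring_eq_mat \<Longrightarrow> x \<noteq> 0 \<Longrightarrow>
      \<not> {p \<in> V \<times> T. Poly_Mapping.lookup x p \<noteq> 0} \<subset> {p \<in> V \<times> T. Poly_Mapping.lookup g p \<noteq> 0}"
    using assms(3) unfolding coloring_circuits_def circuits_def
      edgeless_support_psubset_iff[OF assms(1,2)] by auto
  have out: "\<And>p. p \<notin> V \<times> T \<Longrightarrow> Poly_Mapping.lookup g p = 0"
    and sum0: "\<And>v. v \<in> V \<Longrightarrow> (\<Sum>i\<in>T. Poly_Mapping.lookup g (v, i)) = 0"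
    using g(1) unfolding coloring_kernel_iff[OF assms(1,2)] by auto
  obtain v i where vi: "Poly_Mapping.lookup g (v, i) \<noteq> 0"
    using g(2) by (metis lookup_zero poly_mapping_eqI surj_pair)
  define y where "y = Abs_poly_mapping (\<lambda>p. if fst p = v then Poly_Mapping.lookup g p else 0)"
  have "finite {p. (if fst p = v then Poly_Mapping.lookup g p else 0) \<noteq> 0}"
    by (rule finite_subset[OF _ finite_lookup[of g]]) auto
  then have y: "Poly_Mapping.lookup y p = (if fst p = v then Poly_Mapping.lookup g p else 0)" for p
    by (simp add: y_def)
  have "(\<Sum>i\<in>T. Poly_Mapping.lookup y (w, i)) = 0" if "w \<in> V" for w
    using sum0[OF that] by (cases "w = v") (simp_all add: y)
  then have "y \<in> mat_ker (V \<times> T) V coloring_eq_mat"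
    unfolding coloring_kernel_iff[OF assms(1,2)] using out by (auto simp: y)
  moreover have "y \<noteq> 0" using vi y[of "(v, i)"] by auto
  ultimately have nsub: "\<not> {p \<in> V \<times> T. Poly_Mapping.lookup y p \<noteq> 0}
      \<subset> {p \<in> V \<times> T. Poly_Mapping.lookup g p \<noteq> 0}"
    by (rule min)
  have "Poly_Mapping.lookup g (w, j) = 0" if w: "w \<noteq> v" for w j
  proof (rule ccontr)
    assume nz: "Poly_Mapping.lookup g (w, j) \<noteq> 0"
    then have "(w, j) \<in> V \<times> T" using out by blast
    then have "(w, j) \<in> {p \<in> V \<times> T. Poly_Mapping.lookup g p \<noteq> 0}"
      and "(w, j) \<notin> {p \<in> V \<times> T. Poly_Mapping.lookup y p \<noteq> 0}"
      using nz w by (simp_all add: y)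
    moreover have "{p \<in> V \<times> T. Poly_Mapping.lookup y p \<noteq> 0}
      \<subseteq> {p \<in> V \<times> T. Poly_Mapping.lookup g p \<noteq> 0}"
      by (auto simp: y split: if_splits)
    ultimately have "{p \<in> V \<times> T. Poly_Mapping.lookup y p \<noteq> 0}
      \<subset> {p \<in> V \<times> T. Poly_Mapping.lookup g p \<noteq> 0}"
      by blast
    with nsub show False by simp
  qed
  then show thesis by (rule that)
qed

text \<open>A kernel vector of strictly smaller support would have at most one nonzero coordinate, whereas
  its coordinates at \<open>v\<close> sum to zero.\<close>

lemma recoloring_in_circuits:
  assumes "finite V" "finite T" "v \<in> V" "a \<in> T" "b \<in> T" "a \<noteq> b"
  shows "Poly_Mapping.single (v, b) 1 - Poly_Mapping.single (v, a) 1 \<in> coloring_circuits V {} T"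
proof -
  define g :: "('a \<times> 'b) \<Rightarrow>\<^sub>0 real"
    where "g = Poly_Mapping.single (v, b) 1 - Poly_Mapping.single (v, a) 1"
  have g: "Poly_Mapping.lookup g p = (if p = (v, b) then 1 else if p = (v, a) then - 1 else 0)" for p
    using assms(6) by (auto simp: g_def lookup_minus lookup_single when_def)
  have "(\<Sum>i\<in>T. Poly_Mapping.lookup g (w, i)) = 0" for w
  proof -
    have "(\<Sum>i\<in>T. Poly_Mapping.lookup g (w, i))
        = (\<Sum>i\<in>T. (if i = b then if w = v then 1 else 0 else 0)
                - (if i = a then if w = v then 1 else 0 else 0))"
      using assms(6) by (intro sum.cong) (auto simp: g)
    also have "\<dots> = 0"
      using assms by (simp add: sum_subtractf)
    finally show ?thesis .
  qed
  then have ker: "g \<in> mat_ker (V \<times> T) V coloring_eq_mat"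
    unfolding coloring_kernel_iff[OF assms(1,2)] using assms(3-5) by (auto simp: g)
  have nz: "g \<noteq> 0" using g[of "(v, b)"] by auto
  have "\<lfloor>Poly_Mapping.lookup g (v, b)\<rfloor> = 1" by (simp add: g)
  then have "1 \<in> (\<lambda>c. \<lfloor>Poly_Mapping.lookup g c\<rfloor>) ` (V \<times> T)"
    using assms(3,5) by force
  then have "Gcd ((\<lambda>c. \<lfloor>Poly_Mapping.lookup g c\<rfloor>) ` (V \<times> T)) = 1"
    by (metis Gcd_1)
  then have coprime: "coprime_integral (V \<times> T) g"
    by (auto simp: coprime_integral_def g)
  have "x = 0" if x: "x \<in> mat_ker (V \<times> T) V coloring_eq_mat"
    and sub: "{p \<in> V \<times> T. Poly_Mapping.lookup x p \<noteq> 0} \<subset> {p \<in> V \<times> T. Poly_Mapping.lookup g p \<noteq> 0}"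
    for x
  proof -
    have out: "\<And>p. p \<notin> V \<times> T \<Longrightarrow> Poly_Mapping.lookup x p = 0"
      and sum0: "(\<Sum>i\<in>T. Poly_Mapping.lookup x (v, i)) = 0"
      using x assms(3) unfolding coloring_kernel_iff[OF assms(1,2)] by auto
    have supp_g: "{p \<in> V \<times> T. Poly_Mapping.lookup g p \<noteq> 0} = {(v, a), (v, b)}"
      using assms(3-5) by (auto simp: g)
    have zero: "Poly_Mapping.lookup x p = 0" if "p \<notin> {(v, a), (v, b)}" for p
      using that sub out unfolding supp_g by blast
    have one_zero: "Poly_Mapping.lookup x (v, a) = 0 \<or> Poly_Mapping.lookup x (v, b) = 0"
      using sub assms(3-5) unfolding supp_g by auto
    have "(\<Sum>i\<in>T. Poly_Mapping.lookup x (v, i)) = (\<Sum>i\<in>{a, b}. Poly_Mapping.lookup x (v, i))"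
      using assms(2,4,5) zero by (intro sum.mono_neutral_right) auto
    then have "Poly_Mapping.lookup x (v, a) + Poly_Mapping.lookup x (v, b) = 0"
      using sum0 assms(6) by simp
    then have "Poly_Mapping.lookup x p = 0" for p
      using one_zero zero by (cases "p \<in> {(v, a), (v, b)}") auto
    then show ?thesis by (intro poly_mapping_eqI) simp
  qed
  then show ?thesis
    using ker nz coprime
    unfolding coloring_circuits_def circuits_def edgeless_support_psubset_iff[OF assms(1,2)]
      g_def[symmetric]
    by blast
qed

section \<open>Walk lengths in edgeless graphs\<close>

lemma card_changed_vertices_le:
  assumes "finite V" "finite T" "circuit_walk P (coloring_circuits V {} T) l x"
  shows "card {v \<in> V. \<exists>i. Poly_Mapping.lookup (x l) (v, i) \<noteq> Poly_Mapping.lookup (x 0) (v, i)} \<le> l"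
proof -
  define D where
    "D k = {v \<in> V. \<exists>i. Poly_Mapping.lookup (x k) (v, i) \<noteq> Poly_Mapping.lookup (x 0) (v, i)}" for k
  have "card (D k) \<le> k" if "k \<le> l" for k
    using that
  proof (induction k)
    case 0
    show ?case by (simp add: D_def)
  next
    case (Suc k)
    then obtain g \<epsilon> where g: "g \<in> coloring_circuits V {} T" and step: "x (Suc k) = x k + \<epsilon> *\<^sub>R g"
      using assms(3) unfolding circuit_walk_def by (meson Suc_le_eq)
    obtain v where v: "\<And>w i. w \<noteq> v \<Longrightarrow> Poly_Mapping.lookup g (w, i) = 0"
      using edgeless_circuit_single_vertex[OF assms(1,2) g] by blast
    have "D (Suc k) \<subseteq> insert v (D k)"
      using v by (auto simp: D_def step lookup_add lookup_scaleR_poly_mapping)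
    then have "card (D (Suc k)) \<le> card (insert v (D k))"
      using assms(1) by (intro card_mono) (auto simp: D_def)
    also have "\<dots> \<le> Suc (card (D k))"
      by (rule card_insert_le_m1) auto
    finally show ?case using Suc by simp
  qed
  then show ?thesis by (simp add: D_def)
qed

lemma edgeless_walk_length_ge:
  assumes "finite V" "finite T" "\<And>v. v \<in> V \<Longrightarrow> \<phi>\<^sub>1 v \<noteq> \<phi>\<^sub>2 v" "proper_walk V {} T \<phi>\<^sub>1 \<phi>\<^sub>2 l x"
  shows "card V \<le> l"
proof -
  have walk: "circuit_walk (coloring_polytope V {} T) (coloring_circuits V {} T) l x"
    and ends: "x 0 = char_vector V \<phi>\<^sub>1" "x l = char_vector V \<phi>\<^sub>2"
    using assms(4) by (auto simp: proper_walk_def)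
  have "\<exists>i. Poly_Mapping.lookup (x l) (v, i) \<noteq> Poly_Mapping.lookup (x 0) (v, i)" if "v \<in> V" for v
    using assms(3)[OF that] that
    by (intro exI[of _ "\<phi>\<^sub>2 v"]) (simp add: ends lookup_char_vector[OF assms(1)])
  then have "{v \<in> V. \<exists>i. Poly_Mapping.lookup (x l) (v, i) \<noteq> Poly_Mapping.lookup (x 0) (v, i)} = V"
    by blast
  then show ?thesis
    using card_changed_vertices_le[OF assms(1,2) walk] by simp
qed

lemma edgeless_proper_coloring: "proper_coloring V {} T \<phi> \<longleftrightarrow> \<phi> \<in> V \<rightarrow> T"
  by (simp add: proper_coloring_def)

text \<open>The vertices are recolored in increasing order. Any order would do: without edges, a mixture of
  the two colorings is proper again.\<close>

lemma edgeless_proper_walk: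
  fixes n :: nat
  assumes "finite T" "\<phi>\<^sub>1 \<in> {..<n} \<rightarrow> T" "\<phi>\<^sub>2 \<in> {..<n} \<rightarrow> T" "\<And>v. v < n \<Longrightarrow> \<phi>\<^sub>1 v \<noteq> \<phi>\<^sub>2 v"
  shows "proper_walk {..<n} {} T \<phi>\<^sub>1 \<phi>\<^sub>2 n
    (\<lambda>k. char_vector {..<n} (\<lambda>v. if v < k then \<phi>\<^sub>2 v else \<phi>\<^sub>1 v))"
proof -
  define \<psi> where "\<psi> k = (\<lambda>v. if v < k then \<phi>\<^sub>2 v else \<phi>\<^sub>1 v)" for k
  have graph: "simple_graph {..<n} {}" by (simp add: simple_graph_def)
  have proper: "proper_coloring {..<n} {} T (\<psi> k)" for k
    using assms(2,3) by (auto simp: edgeless_proper_coloring \<psi>_def)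
  let ?P = "coloring_polytope {..<n} {} T"
  have step: "\<exists>g\<in>coloring_circuits {..<n} {} T. \<exists>\<epsilon>>0.
      char_vector {..<n} (\<psi> (Suc k)) = char_vector {..<n} (\<psi> k) + \<epsilon> *\<^sub>R g \<and>
      (\<forall>\<delta>>\<epsilon>. char_vector {..<n} (\<psi> k) + \<delta> *\<^sub>R g \<notin> ?P)" if k: "k < n" for k
  proof -
    define g :: "nat \<times> 'a \<Rightarrow>\<^sub>0 real"
      where "g = Poly_Mapping.single (k, \<phi>\<^sub>2 k) 1 - Poly_Mapping.single (k, \<phi>\<^sub>1 k) 1"
    have in_T: "\<phi>\<^sub>1 k \<in> T" "\<phi>\<^sub>2 k \<in> T" using assms(2,3) k by auto
    have circ: "g \<in> coloring_circuits {..<n} {} T"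
      unfolding g_def using assms(1,4) in_T k by (intro recoloring_in_circuits) auto
    have g: "Poly_Mapping.lookup g p
        = (if p = (k, \<phi>\<^sub>2 k) then 1 else if p = (k, \<phi>\<^sub>1 k) then - 1 else 0)" for p
      using assms(4)[OF k] by (auto simp: g_def lookup_minus lookup_single when_def)
    have move: "char_vector {..<n} (\<psi> (Suc k)) = char_vector {..<n} (\<psi> k) + 1 *\<^sub>R g"
      using k assms(4)[OF k]
      by (intro poly_mapping_eqI)
        (auto simp: lookup_char_vector_if lookup_add lookup_scaleR_poly_mapping g \<psi>_def less_Suc_eq split: if_splits)
    \<comment> \<open>The coordinate of the old color reaches \<open>0\<close> after a step of length \<open>1\<close>.\<close>
    have "char_vector {..<n} (\<psi> k) + \<delta> *\<^sub>R g \<notin> ?P" if "\<delta> > 1" for \<delta>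
    proof
      assume "char_vector {..<n} (\<psi> k) + \<delta> *\<^sub>R g \<in> ?P"
      then have "0 \<le> Poly_Mapping.lookup (char_vector {..<n} (\<psi> k) + \<delta> *\<^sub>R g) (k, \<phi>\<^sub>1 k)"
        using k in_T by (auto simp: coloring_polytope_def)
      also have "\<dots> = 1 - \<delta>"
        using k assms(4)[OF k] by (simp add: lookup_add lookup_scaleR_poly_mapping g lookup_char_vector \<psi>_def)
      finally show False using that by simp
    qed
    then show ?thesis using circ move zero_less_one by blast
  qed
  have "char_vector {..<n} (\<psi> 0) = char_vector {..<n} \<phi>\<^sub>1"
    by (simp add: \<psi>_def)
  moreover have "char_vector {..<n} (\<psi> n) = char_vector {..<n} \<phi>\<^sub>2"
    by (intro poly_mapping_eqI) (auto simp: lookup_char_vector_if \<psi>_def)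
  moreover have "circuit_walk ?P (coloring_circuits {..<n} {} T) n (\<lambda>k. char_vector {..<n} (\<psi> k))"
    unfolding circuit_walk_def
    using step char_vector_in_polytope[OF graph assms(1) proper]
      char_vector_extreme_point[OF graph assms(1) proper] by blast
  ultimately show ?thesis
    unfolding proper_walk_def \<psi>_def[symmetric] using proper by blast
qed

theorem theorem3p6:
  fixes n :: nat
  assumes "n \<ge> 1"
  shows "\<exists>(V :: nat set) (E :: nat set set) (T :: nat set) \<phi>\<^sub>1 \<phi>\<^sub>2.
           simple_graph V E \<and> card V = n \<and> finite T \<and>
           proper_coloring V E T \<phi>\<^sub>1 \<and> proper_coloring V E T \<phi>\<^sub>2 \<and>
           (\<exists>x. shortest_proper_walk V E T \<phi>\<^sub>1 \<phi>\<^sub>2 n x)"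
proof -
  define T :: "nat set" where "T = {0, 1}"
  define \<phi>\<^sub>1 \<phi>\<^sub>2 :: "nat \<Rightarrow> nat" where "\<phi>\<^sub>1 = (\<lambda>_. 0)" and "\<phi>\<^sub>2 = (\<lambda>_. 1)"
  have T: "finite T" and \<phi>: "\<phi>\<^sub>1 \<in> {..<n} \<rightarrow> T" "\<phi>\<^sub>2 \<in> {..<n} \<rightarrow> T" and diff: "\<phi>\<^sub>1 v \<noteq> \<phi>\<^sub>2 v" for v
    by (auto simp: T_def \<phi>\<^sub>1_def \<phi>\<^sub>2_def)
  have "n \<le> l" if "proper_walk {..<n} {} T \<phi>\<^sub>1 \<phi>\<^sub>2 l y" for l y
    using edgeless_walk_length_ge[OF finite_lessThan T diff that] by simp
  then have "\<exists>x. shortest_proper_walk {..<n} {} T \<phi>\<^sub>1 \<phi>\<^sub>2 n x"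
    using edgeless_proper_walk[OF T \<phi> diff] unfolding shortest_proper_walk_def by blast
  moreover have "simple_graph {..<n} {}" by (simp add: simple_graph_def)
  ultimately show ?thesis
    using T \<phi> card_lessThan unfolding edgeless_proper_coloring[symmetric] by blast
qed

end
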